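(* Let $a,b\in\mathbb{B}^2\setminus\{0\}$ be distinct points. Let $k$ be the point of the hyperbolic line $J^*[a,b]$ that is closest to the origin; that is, $k=0$ if $a,b,0$ are collinear, and otherwise $$k=\frac{o_{ab}}{t}\big(t-\sqrt{t^2-1}\big),\qquad t=|o_{ab}|,$$ where $o_{ab}$ is the center of the circle through $a$ and $b$ orthogonal to the unit circle. Let $h_{ab}$ be the hyperbolic midpoint of $a$ and $b$. Then there are Möbius transformations $m_j:\mathbb{B}^2\to\mathbb{B}^2$ (onto), $j=1,2,3$, such that: (1) $m_1(a)=-m_1(b)$ and $\mathrm{Lip}(m_1)\le \mathrm{Lip}(T_{h_{ab}})=\dfrac{1+|h_{ab}|}{1-|h_{ab}|}$; (2) $m_2(a),m_2(b),0$ are collinear and $\mathrm{Lip}(m_2)\le \mathrm{Lip}(T_k)=\dfrac{1+|k|}{1-|k|}$; (3) if $h_{ab}\ne 0$, $k\neq0$ and $|h_{ab}|\ne|k|$ (so that $T_{h_{ab},k}$ is defined), then $|m_3(a)|=|m_3(b)|$ and $\mathrm{Lip}(m_3)\le \mathrm{Lip}(T_{h_{ab},k})$.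
   Context: $\mathbb{B}^2$ is the open unit disk in $\mathbb{C}=\mathbb{R}^2$. The hyperbolic metric $\rho$ of $\mathbb{B}^2$ is given by $\sinh\frac{\rho(x,y)}{2}=\frac{|x-y|}{\sqrt{(1-|x|^2)(1-|y|^2)}}$. For distinct $x,y\in\mathbb{B}^2$, the hyperbolic line $J^*[x,y]$ is the diameter of the unit disk through $x,y$ if $x,y,0$ are collinear, and otherwise the arc inside $\mathbb{B}^2$ of the circle through $x,y$ orthogonal to the unit circle. The hyperbolic midpoint of $x,y\in\mathbb{B}^2$ is the unique point $z\in\mathbb{B}^2$ with $\rho(x,z)=\rho(y,z)=\rho(x,y)/2$. For $u\in\mathbb{B}^2$, $T_u(z)=\dfrac{z-u}{1-\overline{u}z}$ (so $T_0$ is the identity). For $u,v\in\mathbb{B}^2\setminus\{0\}$ with $|u|\ne|v|$, $$T_{u,v}(z)=\frac{v}{\overline{v}}\,\frac{\overline{c}z-1}{z-c},\qquad c=\frac{u-v+uv(\overline{u}-\overline{v})}{|u|^2-|v|^2},$$ which is a Möbius transformation of $\mathbb{B}^2$ onto itself with $T_{u,v}(u)=v$. For $f:\mathbb{B}^2\to\mathbb{B}^2$, $\mathrm{Lip}(f)=\sup\{|f(x)-f(y)|/|x-y| : x,y\in\mathbb{B}^2,\ x\ne y\}$ is the Lipschitz constant with respect to the Euclidean metric. *)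

theory Defs
  imports "HOL-Analysis.Analysis"
begin

abbreviation unit_disk :: "complex set" where
  "unit_disk \<equiv> ball 0 1"

definition hyp_dist :: "complex \<Rightarrow> complex \<Rightarrow> real" where
  "hyp_dist x y = 2 * arsinh (norm (x - y) / sqrt ((1 - (norm x)\<^sup>2) * (1 - (norm y)\<^sup>2)))"

lemma sinh_half_hyp_dist:
  "sinh (hyp_dist x y / 2) = norm (x - y) / sqrt ((1 - (norm x)\<^sup>2) * (1 - (norm y)\<^sup>2))"
  by (simp add: hyp_dist_def)

definition hyp_midpoint :: "complex \<Rightarrow> complex \<Rightarrow> complex" where
  "hyp_midpoint x y = (THE z. z \<in> unit_disk \<and>
     hyp_dist x z = hyp_dist x y / 2 \<and> hyp_dist y z = hyp_dist x y / 2)"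

text \<open>Two circles, given by centres and radii, are orthogonal if they meet and their radii
  are perpendicular at each common point.\<close>

definition orthogonal_circles :: "complex \<Rightarrow> real \<Rightarrow> complex \<Rightarrow> real \<Rightarrow> bool" where
  "orthogonal_circles p r q s \<longleftrightarrow>
     sphere p r \<inter> sphere q s \<noteq> {} \<and>
     (\<forall>z \<in> sphere p r \<inter> sphere q s. orthogonal (z - p) (z - q))"

text \<open>The following two are meaningful only if \<open>x\<close>, \<open>y\<close> and \<open>0\<close> are not collinear; the
  circle is then unique.\<close>

definition orth_center :: "complex \<Rightarrow> complex \<Rightarrow> complex" where
  "orth_center x y = (THE p. \<exists>r>0. x \<in> sphere p r \<and> y \<in> sphere p r \<and> orthogonal_circles p r 0 1)"

definition orth_circle :: "complex \<Rightarrow> complex \<Rightarrow> complex set" where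
  "orth_circle x y = sphere (orth_center x y) (dist (orth_center x y) x)"

definition hyp_line :: "complex \<Rightarrow> complex \<Rightarrow> complex set" where
  "hyp_line x y =
     (if collinear {x, y, 0} then affine hull {x, y} else orth_circle x y) \<inter> unit_disk"

definition hyp_line_nearest_origin :: "complex \<Rightarrow> complex \<Rightarrow> complex" where
  "hyp_line_nearest_origin x y =
     (THE k. k \<in> hyp_line x y \<and> (\<forall>z \<in> hyp_line x y. norm k \<le> norm z))"

definition T1 :: "complex \<Rightarrow> complex \<Rightarrow> complex" where
  "T1 u z = (z - u) / (1 - cnj u * z)"

definition T2 :: "complex \<Rightarrow> complex \<Rightarrow> complex \<Rightarrow> complex" where
  "T2 u v z =
     (let c = (u - v + u * v * (cnj u - cnj v)) / complex_of_real ((norm u)\<^sup>2 - (norm v)\<^sup>2)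
      in v / cnj v * ((cnj c * z - 1) / (z - c)))"

text \<open>Only the values on the disk matter. Injectivity follows from \<open>\<alpha> * \<delta> - \<beta> * \<gamma> \<noteq> 0\<close>.\<close>

definition disk_moebius :: "(complex \<Rightarrow> complex) \<Rightarrow> bool" where
  "disk_moebius f \<longleftrightarrow>
     (\<exists>\<alpha> \<beta> \<gamma> \<delta>. \<alpha> * \<delta> - \<beta> * \<gamma> \<noteq> 0 \<and>
        (\<forall>z \<in> unit_disk. \<gamma> * z + \<delta> \<noteq> 0 \<and> f z = (\<alpha> * z + \<beta>) / (\<gamma> * z + \<delta>))) \<and>
     f ` unit_disk = unit_disk"

text \<open>The supremum is taken in the extended reals, so it is \<open>\<infinity>\<close> when \<open>f\<close> is not Lipschitz on
  the disk.\<close>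

definition Lip :: "(complex \<Rightarrow> complex) \<Rightarrow> ereal" where
  "Lip f = Sup {ereal (norm (f x - f y) / norm (x - y)) | x y.
                  x \<in> unit_disk \<and> y \<in> unit_disk \<and> x \<noteq> y}"

end

theory Submission
  imports Defs
begin

text \<open>Conditions (1) and (2) hold for \<open>m1 = T1 h\<close> and \<open>m2 = T1 k\<close>: moving \<open>h\<close> to the origin makes
  \<open>a\<close> and \<open>b\<close> antipodal, and moving any point of the geodesic to the origin turns the geodesic
  into a diameter. For (3), \<open>m3 = T2 h k\<close> is the inversion in the circle with centre \<open>c\<close>
  orthogonal to the unit circle that interchanges \<open>h\<close> and \<open>k\<close>, followed by the reflection in
  the line through \<open>0\<close> and \<open>k\<close>. It preserves the geodesic and moves its points \<open>a\<close>, \<open>b\<close>,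
  which are symmetric about \<open>h\<close>, to points symmetric about \<open>k\<close>, the foot of the perpendicular from \<open>0\<close>.

  Off the diameters, a geodesic is encoded by the centre \<open>p\<close> of its circle: orthogonality to the
  unit circle makes \<open>x\<close> lie on it iff \<open>2 Re (x * cnj p) = 1 + |x|\<^sup>2\<close>.\<close>

subsection \<open>Disk automorphisms\<close>

lemma one_minus_cnj_mult_nonzero:
  assumes "norm u < 1" "norm z < 1"
  shows "1 - cnj u * z \<noteq> 0"
proof
  assume "1 - cnj u * z = 0"
  then have "norm (cnj u * z) = 1" by simp
  moreover have "norm u * norm z < 1 * 1"
    using assms by (intro mult_strict_mono') auto
  ultimately show False by (simp add: norm_mult)
qed

text \<open>Dividing by \<open>(norm (1 - cnj u * z))\<^sup>2\<close> gives the factor by which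
  \<open>T1 u\<close> changes \<open>1 - (norm z)\<^sup>2\<close>. Invariance of the disk and of the
  metric both rest on this.\<close>

lemma norm_one_minus_cnj_mult:
  "(norm (1 - cnj u * z))\<^sup>2 - (norm (z - u))\<^sup>2 = (1 - (norm u)\<^sup>2) * (1 - (norm z)\<^sup>2)"
  unfolding cmod_power2 by (simp add: power2_eq_square algebra_simps)

lemma one_minus_norm_T1:
  assumes "norm u < 1" "norm z < 1"
  shows "1 - (norm (T1 u z))\<^sup>2 = (1 - (norm u)\<^sup>2) * (1 - (norm z)\<^sup>2) / (norm (1 - cnj u * z))\<^sup>2"
  using one_minus_cnj_mult_nonzero[OF assms] norm_one_minus_cnj_mult[of u z, symmetric]
  by (simp add: T1_def norm_divide power_divide field_simps)

lemma one_minus_norm_sq_pos: "norm (z::complex) < 1 \<Longrightarrow> 0 < 1 - (norm z)\<^sup>2"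
  by (simp add: power_less_one_iff)

lemma norm_T1_less_1:
  assumes "norm u < 1" "norm z < 1"
  shows "norm (T1 u z) < 1"
proof -
  have "0 < 1 - (norm (T1 u z))\<^sup>2"
    unfolding one_minus_norm_T1[OF assms]
    using one_minus_cnj_mult_nonzero[OF assms] assms
    by (intro divide_pos_pos mult_pos_pos one_minus_norm_sq_pos) auto
  then show ?thesis by (simp add: power_less_one_iff)
qed

lemma T1_0: "T1 0 z = z"
  by (simp add: T1_def)

lemma T1_self: "T1 u u = 0"
  by (simp add: T1_def)

text \<open>This exact form of the difference yields both the isometry property and the Euclidean
  difference quotients.\<close>

lemma T1_diff:
  assumes "norm u < 1" "norm x < 1" "norm y < 1"
  shows "T1 u x - T1 u y =
    of_real (1 - (norm u)\<^sup>2) * (x - y) / ((1 - cnj u * x) * (1 - cnj u * y))"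
proof -
  have "1 - cnj u * x \<noteq> 0" "1 - cnj u * y \<noteq> 0"
    using assms one_minus_cnj_mult_nonzero by auto
  moreover have "(x - u) * (1 - cnj u * y) - (y - u) * (1 - cnj u * x) = (1 - u * cnj u) * (x - y)"
    by (simp add: algebra_simps)
  ultimately show ?thesis
    unfolding of_real_diff of_real_1 complex_norm_square T1_def by (subst diff_frac_eq) auto
qed

lemma T1_T1_minus:
  assumes "norm u < 1" "norm z < 1"
  shows "T1 u (T1 (- u) z) = z"
proof -
  let ?d = "1 + cnj u * z" and ?e = "1 - u * cnj u"
  have d: "?d \<noteq> 0" using one_minus_cnj_mult_nonzero[of "-u" z] assms by simp
  have e: "?e \<noteq> 0" using one_minus_cnj_mult_nonzero[of "u" u] assms by (simp add: mult.commute)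
  have "(z + u) / ?d - u = z * ?e / ?d" "1 - cnj u * ((z + u) / ?d) = ?e / ?d"
    using d by (simp_all add: field_simps)
  then show ?thesis using d e by (simp add: T1_def)
qed

text \<open>The rotation factor is included because \<open>T2\<close> is a rotated
  \<open>T1\<close>. Surjectivity comes from the inverse \<open>T1 (- u)\<close>.\<close>

lemma disk_moebius_rotated_T1:
  assumes u: "norm u < 1" and \<theta>: "norm \<theta> = 1"
  shows "disk_moebius (\<lambda>z. \<theta> * T1 u z)"
  unfolding disk_moebius_def
proof (intro conjI exI ballI)
  have "1 - cnj u * u \<noteq> 0" using one_minus_cnj_mult_nonzero u by blast
  moreover have "\<theta> * 1 - (- \<theta> * u) * (- cnj u) = \<theta> * (1 - cnj u * u)"
    by (simp add: algebra_simps)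
  ultimately show "\<theta> * 1 - (- \<theta> * u) * (- cnj u) \<noteq> 0" using \<theta> by auto
  fix z :: complex assume "z \<in> unit_disk"
  then have "1 - cnj u * z \<noteq> 0" using one_minus_cnj_mult_nonzero u by simp
  then show "- cnj u * z + 1 \<noteq> 0" "\<theta> * T1 u z = (\<theta> * z + - \<theta> * u) / (- cnj u * z + 1)"
    by (simp_all add: T1_def algebra_simps)
next
  show "(\<lambda>z. \<theta> * T1 u z) ` unit_disk = unit_disk"
  proof (intro equalityI subsetI)
    fix w assume w: "w \<in> unit_disk"
    let ?z = "T1 (- u) (w / \<theta>)"
    have "norm (w / \<theta>) < 1" using w \<theta> by (simp add: norm_divide)
    then have "norm ?z < 1" "\<theta> * T1 u ?z = w"
      using u \<theta> by (auto simp: norm_T1_less_1 T1_T1_minus)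
    then show "w \<in> (\<lambda>z. \<theta> * T1 u z) ` unit_disk" by force
  qed (use u \<theta> in \<open>auto simp: norm_mult norm_T1_less_1\<close>)
qed

lemma disk_moebius_T1: "norm u < 1 \<Longrightarrow> disk_moebius (T1 u)"
  using disk_moebius_rotated_T1[of u 1] by simp

text \<open>The difference quotient has two denominator factors \<open>norm (1 - cnj u * x)\<close>
  and \<open>norm (1 - cnj u * y)\<close>, each at least \<open>1 - norm u\<close>. The resulting
  bound is approached as both points tend to the boundary in the direction of
  \<open>u\<close>.\<close>

lemma Lip_T1:
  assumes u: "norm u < 1"
  shows "Lip (T1 u) = ereal ((1 + norm u) / (1 - norm u))"
proof (rule antisym)
  let ?r = "norm u"
  have L: "(1 + ?r) / (1 - ?r) = (1 - ?r\<^sup>2) / ((1 - ?r) * (1 - ?r))"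
  proof -
    have "1 - ?r\<^sup>2 = (1 + ?r) * (1 - ?r)" by (simp add: algebra_simps power2_eq_square)
    then show ?thesis using u by simp
  qed
  have ratio: "norm (T1 u x - T1 u y) / norm (x - y)
      = (1 - ?r\<^sup>2) / (norm (1 - cnj u * x) * norm (1 - cnj u * y))"
    if "norm x < 1" "norm y < 1" "x \<noteq> y" for x y
  proof -
    have "\<bar>1 - ?r\<^sup>2\<bar> = 1 - ?r\<^sup>2" using one_minus_norm_sq_pos[OF u] by simp
    moreover have "norm (x - y) \<noteq> 0" using that(3) by simp
    moreover have "A * n / B / n = A / B" if "n \<noteq> 0" for A B n :: real
      using that by simp
    ultimately show ?thesis
      unfolding T1_diff[OF u that(1,2)] norm_mult norm_divide norm_of_real
      by (simp only:)
  qed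
  have lower: "1 - ?r \<le> norm (1 - cnj u * x)" if "norm x < 1" for x
  proof -
    have "norm (cnj u * x) \<le> ?r"
      using that by (simp add: norm_mult mult_left_le)
    then show ?thesis using norm_triangle_ineq2[of 1 "cnj u * x"] by simp
  qed
  show "Lip (T1 u) \<le> ereal ((1 + ?r) / (1 - ?r))"
    unfolding Lip_def
  proof (rule Sup_least, clarify)
    fix x y assume *: "x \<in> unit_disk" "y \<in> unit_disk" "x \<noteq> y"
    then have x: "1 - ?r \<le> norm (1 - cnj u * x)" and y: "1 - ?r \<le> norm (1 - cnj u * y)"
      by (auto intro: lower)
    then have "(1 - ?r) * (1 - ?r) \<le> norm (1 - cnj u * x) * norm (1 - cnj u * y)"
      using u by (intro mult_mono) auto
    then have "(1 - ?r\<^sup>2) / (norm (1 - cnj u * x) * norm (1 - cnj u * y)) \<le> (1 - ?r\<^sup>2) / ((1 - ?r) * (1 - ?r))"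
      using u x y one_minus_norm_sq_pos[OF u]
      by (intro divide_left_mono) (auto intro!: mult_pos_pos simp del: zero_less_norm_iff)
    then show "ereal (norm (T1 u x - T1 u y) / norm (x - y)) \<le> ereal ((1 + ?r) / (1 - ?r))"
      using ratio[of x y] * by (simp add: L)
  qed
  \<comment> \<open>The boundary point in the direction of \<open>u\<close>. For
    \<open>u = 0\<close> every direction serves.\<close>
  define e where "e = (if u = 0 then 1 else sgn u)"
  have e: "norm e = 1" "cnj u * e = of_real ?r"
  proof -
    show "norm e = 1" by (simp add: e_def norm_sgn)
    have "cnj u * u = of_real ?r * of_real ?r"
      using complex_norm_square[of u] by (simp add: power2_eq_square mult.commute)
    then show "cnj u * e = of_real ?r" by (simp add: e_def sgn_eq)
  qed
  \<comment> \<open>The test pair is \<open>s * e\<close>, \<open>s\<^sup>2 * e\<close>: distinct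
    for \<open>0 < s < 1\<close>, with both points tending to \<open>e\<close> as \<open>s\<close>
    tends to 1.\<close>
  have "((\<lambda>s. (1 - ?r\<^sup>2) / ((1 - ?r * s) * (1 - ?r * s\<^sup>2))) \<longlongrightarrow>
      (1 - ?r\<^sup>2) / ((1 - ?r * 1) * (1 - ?r * 1\<^sup>2))) (at_left 1)"
    using u by (intro tendsto_intros) auto
  then have lim: "((\<lambda>s. ereal ((1 - ?r\<^sup>2) / ((1 - ?r * s) * (1 - ?r * s\<^sup>2)))) \<longlongrightarrow>
      ereal ((1 + ?r) / (1 - ?r))) (at_left 1)"
    by (simp add: L)
  show "ereal ((1 + ?r) / (1 - ?r)) \<le> Lip (T1 u)"
  proof (rule tendsto_upperbound[OF lim])
    have "eventually (\<lambda>s::real. s \<in> {0<..<1}) (at_left 1)"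
      by (rule eventually_at_leftI[of 0]) auto
    then show "eventually (\<lambda>s. ereal ((1 - ?r\<^sup>2) / ((1 - ?r * s) * (1 - ?r * s\<^sup>2))) \<le> Lip (T1 u)) (at_left 1)"
    proof eventually_elim
      case (elim s)
      let ?x = "of_real s * e" and ?y = "of_real (s\<^sup>2) * e"
      have s2: "s\<^sup>2 < s" using elim by (simp add: power2_eq_square)
      have nx: "norm ?x < 1" "norm ?y < 1"
        using elim e s2 by (auto simp: norm_mult norm_power simp del: of_real_power)
      have "?x \<noteq> ?y"
        using e s2 by (metis mult_cancel_right norm_zero of_real_eq_iff order_less_irrefl zero_neq_one)
      moreover have "?r * s < 1" "?r * s\<^sup>2 < 1"
        using elim u s2 mult_strict_mono'[of ?r 1 s 1] mult_strict_mono'[of ?r 1 "s\<^sup>2" 1] by auto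
      moreover have "cnj u * ?x = of_real (?r * s)" "cnj u * ?y = of_real (?r * s\<^sup>2)"
        using e(2) by (simp_all add: mult.left_commute[of "cnj u"] mult.commute)
      moreover from calculation have "norm (1 - cnj u * ?x) = 1 - ?r * s" "norm (1 - cnj u * ?y) = 1 - ?r * s\<^sup>2"
        by (metis abs_of_pos diff_gt_0_iff_gt norm_of_real of_real_1 of_real_diff)+
      ultimately have "norm (T1 u ?x - T1 u ?y) / norm (?x - ?y) = (1 - ?r\<^sup>2) / ((1 - ?r * s) * (1 - ?r * s\<^sup>2))"
        using ratio[OF nx] by simp
      then show ?case
        unfolding Lip_def using nx \<open>?x \<noteq> ?y\<close>
        by (intro Sup_upper CollectI exI[of _ ?x] exI[of _ ?y]) auto
    qed
  qed simp
qed

subsection \<open>The hyperbolic midpoint\<close>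

lemma hyp_dist_T1:
  assumes "norm u < 1" "norm x < 1" "norm y < 1"
  shows "hyp_dist (T1 u x) (T1 u y) = hyp_dist x y"
proof -
  let ?U = "1 - (norm u)\<^sup>2" and ?X = "norm (1 - cnj u * x)" and ?Y = "norm (1 - cnj u * y)"
  have pos: "0 < ?U" "?X > 0" "?Y > 0"
    using assms one_minus_norm_sq_pos one_minus_cnj_mult_nonzero by auto
  have "norm (T1 u x - T1 u y) = ?U / (?X * ?Y) * norm (x - y)"
    unfolding T1_diff[OF assms] norm_mult norm_divide norm_of_real using pos by simp
  moreover have "(1 - (norm (T1 u x))\<^sup>2) * (1 - (norm (T1 u y))\<^sup>2)
      = (?U / (?X * ?Y))\<^sup>2 * ((1 - (norm x)\<^sup>2) * (1 - (norm y)\<^sup>2))"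
    unfolding one_minus_norm_T1[OF assms(1,2)] one_minus_norm_T1[OF assms(1,3)]
    by (simp add: power2_eq_square mult_ac)
  ultimately show ?thesis
    unfolding hyp_dist_def using pos by (simp add: real_sqrt_mult)
qed

text \<open>The midpoint criterion at the origin. Equal distances to 0 force equal norms. The
  doubling formula for \<open>sinh\<close> then turns the half-distance condition into
  \<open>norm (s - t) = 2 * norm s\<close>, and the parallelogram law leaves
  \<open>s + t = 0\<close>.\<close>

lemma hyp_dist_half_iff:
  assumes "norm s < 1" "norm t < 1"
  shows "hyp_dist s 0 = hyp_dist s t / 2 \<and> hyp_dist t 0 = hyp_dist s t / 2 \<longleftrightarrow> s = - t"
proof -
  have pos: "0 < 1 - (norm s)\<^sup>2" "0 < 1 - (norm t)\<^sup>2"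
    using assms one_minus_norm_sq_pos by auto
  have norm_eq: "norm s = norm t" if "hyp_dist s 0 = hyp_dist t 0"
  proof -
    from that have "norm s / sqrt (1 - (norm s)\<^sup>2) = norm t / sqrt (1 - (norm t)\<^sup>2)"
      by (simp add: hyp_dist_def) (metis sinh_arsinh_real)
    then have "(norm s / sqrt (1 - (norm s)\<^sup>2))\<^sup>2 = (norm t / sqrt (1 - (norm t)\<^sup>2))\<^sup>2"
      by simp
    then have "(norm s)\<^sup>2 / (1 - (norm s)\<^sup>2) = (norm t)\<^sup>2 / (1 - (norm t)\<^sup>2)"
      using pos by (simp add: power_divide)
    then have "(norm s)\<^sup>2 = (norm t)\<^sup>2"
      using pos by (simp add: field_simps)
    then show ?thesis by simp
  qed
  have half: "hyp_dist s 0 = hyp_dist s t / 2 \<longleftrightarrow> norm (s - t) = 2 * norm s" if "norm s = norm t"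
  proof -
    let ?q = "1 - (norm s)\<^sup>2"
    have q: "?q > 0" by fact
    let ?A = "norm s / sqrt ?q" and ?C = "norm (s - t) / ?q"
    have d: "hyp_dist s 0 = 2 * arsinh ?A" "hyp_dist s t / 2 = arsinh ?C"
      using that q by (simp_all add: hyp_dist_def)
    have "1 + ?A\<^sup>2 = 1 / ?q" using q by (simp add: power_divide field_simps)
    then have ch: "cosh (arsinh ?A) = 1 / sqrt ?q"
      by (simp add: cosh_arsinh_real real_sqrt_divide add.commute)
    have "sinh (2 * arsinh ?A) = 2 * norm s / ?q"
      unfolding sinh_double ch using q by simp
    then show ?thesis unfolding d using q
      by (metis arsinh_sinh_real divide_cancel_right less_irrefl sinh_arsinh_real)
  qed
  show ?thesis
  proof
    assume L: "hyp_dist s 0 = hyp_dist s t / 2 \<and> hyp_dist t 0 = hyp_dist s t / 2"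
    then have n: "norm s = norm t" using norm_eq by simp
    then have "norm (s - t) = 2 * norm s" using half L by simp
    moreover have "(norm (s + t))\<^sup>2 = 2 * (norm s)\<^sup>2 + 2 * (norm t)\<^sup>2 - (norm (s - t))\<^sup>2"
      unfolding cmod_power2 by (simp add: power2_eq_square algebra_simps)
    ultimately have "(norm (s + t))\<^sup>2 = 0" using n by (simp add: power_mult_distrib)
    then show "s = - t" by (simp add: eq_neg_iff_add_eq_0)
  next
    assume R: "s = - t"
    have "norm (s - t) = 2 * norm s" using norm_mult[of "-2" t] by (simp add: R)
    moreover have "hyp_dist t 0 = hyp_dist s 0" by (simp add: hyp_dist_def R)
    ultimately show "hyp_dist s 0 = hyp_dist s t / 2 \<and> hyp_dist t 0 = hyp_dist s t / 2"
      using half R by simp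
  qed
qed

text \<open>The isometry \<open>T1 z\<close> moves \<open>z\<close> to 0, which reduces the claim to
  the criterion at the origin.\<close>

lemma equidistant_iff_T1_antipodal:
  assumes "norm a < 1" "norm b < 1" "norm z < 1"
  shows "hyp_dist a z = hyp_dist a b / 2 \<and> hyp_dist b z = hyp_dist a b / 2 \<longleftrightarrow> T1 z a = - T1 z b"
  using hyp_dist_half_iff[of "T1 z a" "T1 z b"] hyp_dist_T1[of z] T1_self[of z] norm_T1_less_1 assms
  by metis

text \<open>The antipodality condition is real-linear in \<open>w = 2 z / (1 + |z|\<^sup>2)\<close>, the point of the
  Klein model that corresponds to \<open>z\<close>; solving it gives the Klein model's midpoint.\<close>

lemma T1_antipodal_iff:
  assumes "norm a < 1" "norm b < 1" "norm z < 1"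
  shows "T1 z a = - T1 z b \<longleftrightarrow>
    2 * z / of_real (1 + (norm z)\<^sup>2) =
      (a * of_real (1 - (norm b)\<^sup>2) + b * of_real (1 - (norm a)\<^sup>2)) / of_real (1 - (norm a * norm b)\<^sup>2)"
    (is "_ \<longleftrightarrow> ?w = ?N / ?D")
proof -
  have nz: "1 - cnj z * a \<noteq> 0" "1 - cnj z * b \<noteq> 0"
    using assms one_minus_cnj_mult_nonzero by auto
  have "norm a * norm b < 1"
    using assms mult_strict_mono'[of "norm a" 1 "norm b" 1] by simp
  then have Dr: "1 - (norm a * norm b)\<^sup>2 > 0"
    by (simp add: power_less_one_iff)
  then have D: "?D \<noteq> 0" unfolding of_real_eq_0_iff by linarith
  have Deq: "?D = 1 - a * b * cnj a * cnj b"
    unfolding of_real_diff of_real_1 power_mult_distrib of_real_mult complex_norm_square by simp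
  have Neq: "?N = (a + b) - a * b * (cnj a + cnj b)"
    unfolding of_real_diff of_real_1 complex_norm_square by (simp add: algebra_simps)
  have Sr: "1 + (norm z)\<^sup>2 > 0" by (simp add: add_pos_nonneg)
  have S: "(of_real (1 + (norm z)\<^sup>2) :: complex) \<noteq> 0" (is "?S \<noteq> 0")
    unfolding of_real_eq_0_iff using Sr by linarith
  have "T1 z a = - T1 z b \<longleftrightarrow> (a - z) * (1 - cnj z * b) + (b - z) * (1 - cnj z * a) = 0"
    unfolding T1_def minus_divide_left frac_eq_eq[OF nz] mult_minus_left eq_neg_iff_add_eq_0 ..
  also have "\<dots> \<longleftrightarrow> ?S * (a + b) = 2 * z + 2 * cnj z * (a * b)"
    unfolding of_real_add of_real_1 complex_norm_square by (auto simp: algebra_simps)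
  also have "\<dots> \<longleftrightarrow> ?w + cnj ?w * (a * b) = a + b"
  proof -
    have "?w + cnj ?w * (a * b) = (2 * z + 2 * cnj z * (a * b)) / ?S"
      by (simp add: add_divide_distrib)
    moreover have "S * t = X \<longleftrightarrow> X / S = t" if "S \<noteq> 0" for S t X :: complex
      using that by (auto simp: field_simps)
    ultimately show ?thesis using S by (simp only:)
  qed
  also have "\<dots> \<longleftrightarrow> ?w = ?N / ?D"
  proof
    assume E: "?w + cnj ?w * (a * b) = a + b"
    \<comment> \<open>The equation and its conjugate form a linear system in \<open>w\<close> and
      \<open>cnj w\<close>; eliminating \<open>cnj w\<close> gives \<open>w\<close>.\<close>
    have "cnj ?w + ?w * (cnj a * cnj b) = cnj a + cnj b"
      using arg_cong[OF E, of cnj] by simp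
    then have "?w * ?D = ?N"
      using E unfolding Deq Neq by algebra
    then show "?w = ?N / ?D" using D by (simp add: eq_divide_eq)
  next
    assume E: "?w = ?N / ?D"
    have cD: "cnj ?D = ?D" by simp
    have add_frac: "X / D + Y / D * q = (X + Y * q) / D" for X Y D q :: complex
      by (simp add: add_divide_distrib)
    have "?N / ?D + cnj (?N / ?D) * (a * b) = (?N + cnj ?N * (a * b)) / ?D"
      unfolding complex_cnj_divide cD by (rule add_frac)
    also have "?N + cnj ?N * (a * b) = (a + b) * ?D"
      unfolding Neq Deq by (simp add: algebra_simps)
    finally show "?w + cnj ?w * (a * b) = a + b" unfolding E using D by simp
  qed
  finally show ?thesis .
qed

text \<open>Taking norms gives \<open>(r - r') * (1 - r * r') = 0\<close> for the two moduli, so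
  they agree and the denominators cancel. This yields uniqueness of the midpoint.\<close>

lemma klein_inj:
  fixes z z' :: complex
  assumes "norm z < 1" "norm z' < 1"
    and E: "2 * z / of_real (1 + (norm z)\<^sup>2) = 2 * z' / of_real (1 + (norm z')\<^sup>2)"
  shows "z = z'"
proof -
  let ?r = "norm z" and ?r' = "norm z'"
  have pos: "0 < 1 + ?r\<^sup>2" "0 < 1 + ?r'\<^sup>2" by (simp_all add: add_pos_nonneg)
  from arg_cong[OF E, of norm] have "2 * ?r / (1 + ?r\<^sup>2) = 2 * ?r' / (1 + ?r'\<^sup>2)"
    unfolding norm_divide norm_mult norm_of_real using pos by simp
  then have "?r * (1 + ?r'\<^sup>2) = ?r' * (1 + ?r\<^sup>2)" using pos by (simp add: field_simps)
  then have "(?r - ?r') * (1 - ?r * ?r') = 0" by (simp add: algebra_simps power2_eq_square)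
  moreover have "?r * ?r' < 1"
    using assms mult_strict_mono'[of ?r 1 ?r' 1] by simp
  ultimately have "?r = ?r'" by simp
  moreover have "(of_real (1 + ?r'\<^sup>2) :: complex) \<noteq> 0"
    unfolding of_real_eq_0_iff using pos by linarith
  ultimately show ?thesis using E by (simp del: of_real_add)
qed

lemma klein_surj:
  fixes w :: complex
  assumes "norm w < 1"
  obtains z where "norm z < 1" "2 * z / of_real (1 + (norm z)\<^sup>2) = w"
proof
  \<comment> \<open>The modulus of \<open>z\<close> is the root below 1 of
    \<open>norm w * r\<^sup>2 - 2 * r + norm w = 0\<close>, written as
    \<open>norm w / (1 + q)\<close> so that \<open>w = 0\<close> needs no separate case.\<close>
  define q where "q = sqrt (1 - (norm w)\<^sup>2)"
  have q2: "q\<^sup>2 = 1 - (norm w)\<^sup>2" and q: "q > 0"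
    using one_minus_norm_sq_pos[OF assms] by (simp_all add: q_def)
  let ?z = "w / of_real (1 + q)"
  have "norm (of_real (1 + q) :: complex) = 1 + q"
    unfolding norm_of_real using q by simp
  then have nz: "norm ?z = norm w / (1 + q)" by (simp add: norm_divide)
  show "norm ?z < 1" unfolding nz using q assms by (simp add: field_simps)
  have "(norm ?z)\<^sup>2 = (1 - q\<^sup>2) / (1 + q)\<^sup>2" unfolding nz by (simp add: power_divide q2)
  also have "1 - q\<^sup>2 = (1 - q) * (1 + q)" by (simp add: algebra_simps power2_eq_square)
  also have "\<dots> / (1 + q)\<^sup>2 = (1 - q) / (1 + q)" using q by (simp add: power2_eq_square)
  finally have "1 + (norm ?z)\<^sup>2 = 2 / (1 + q)" using q by (simp add: field_simps)
  moreover have "(of_real (1 + q) :: complex) \<noteq> 0"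
    unfolding of_real_eq_0_iff using q by linarith
  ultimately show "2 * ?z / of_real (1 + (norm ?z)\<^sup>2) = w"
    by (simp only: of_real_divide) simp
qed

text \<open>The Klein midpoint \<open>w\<close> lies in the disk because
  \<open>norm a + norm b < 1 + norm a * norm b\<close>. Its preimage under the Klein map is then the
  unique midpoint, so the definite description is justified.\<close>

lemma hyp_midpoint:
  assumes a: "norm a < 1" and b: "norm b < 1"
  shows "norm (hyp_midpoint a b) < 1"
    and "T1 (hyp_midpoint a b) a = - T1 (hyp_midpoint a b) b"
proof -
  let ?D = "1 - (norm a * norm b)\<^sup>2"
  define w where "w = (a * of_real (1 - (norm b)\<^sup>2) + b * of_real (1 - (norm a)\<^sup>2)) / of_real ?D"
  have ab: "norm a * norm b < 1"
    using assms mult_strict_mono'[of "norm a" 1 "norm b" 1] by simp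
  then have D: "?D > 0"
    by (simp add: power_less_one_iff)
  have "norm (a * of_real (1 - (norm b)\<^sup>2) + b * of_real (1 - (norm a)\<^sup>2))
      \<le> norm a * \<bar>1 - (norm b)\<^sup>2\<bar> + norm b * \<bar>1 - (norm a)\<^sup>2\<bar>"
    by (rule norm_triangle_le) (simp only: norm_mult norm_of_real order_refl)
  also have "\<dots> = (norm a + norm b) * (1 - norm a * norm b)"
    using one_minus_norm_sq_pos[OF a] one_minus_norm_sq_pos[OF b]
    by (simp add: algebra_simps power2_eq_square)
  also have "\<dots> < (1 + norm a * norm b) * (1 - norm a * norm b)"
  proof (rule mult_strict_right_mono)
    have "0 < (1 - norm a) * (1 - norm b)" using a b by simp
    then show "norm a + norm b < 1 + norm a * norm b" by (simp add: algebra_simps)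
  qed (use ab in simp)
  also have "\<dots> = ?D" by (simp add: algebra_simps power2_eq_square)
  finally have "norm w < 1"
    unfolding w_def norm_divide norm_of_real using D by (simp add: divide_less_eq)
  then obtain z where z: "norm z < 1" "2 * z / of_real (1 + (norm z)\<^sup>2) = w"
    by (rule klein_surj)
  have "\<exists>!z. z \<in> unit_disk \<and> hyp_dist a z = hyp_dist a b / 2 \<and> hyp_dist b z = hyp_dist a b / 2"
  proof (rule ex1I[of _ z])
    show "z \<in> unit_disk \<and> hyp_dist a z = hyp_dist a b / 2 \<and> hyp_dist b z = hyp_dist a b / 2"
      using equidistant_iff_T1_antipodal[OF a b z(1)] T1_antipodal_iff[OF a b z(1)] z
      by (simp add: w_def)
    fix z' assume "z' \<in> unit_disk \<and> hyp_dist a z' = hyp_dist a b / 2 \<and> hyp_dist b z' = hyp_dist a b / 2"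
    then have z': "norm z' < 1" "T1 z' a = - T1 z' b"
      using equidistant_iff_T1_antipodal[OF a b] by auto
    then have "2 * z' / of_real (1 + (norm z')\<^sup>2) = w"
      unfolding w_def using T1_antipodal_iff[OF a b z'(1)] by blast
    then show "z' = z" using klein_inj[OF z'(1) z(1)] z(2) by simp
  qed
  from theI'[OF this] show "norm (hyp_midpoint a b) < 1"
    "T1 (hyp_midpoint a b) a = - T1 (hyp_midpoint a b) b"
    unfolding hyp_midpoint_def[symmetric] using equidistant_iff_T1_antipodal[OF a b] by auto
qed

subsection \<open>Geodesics\<close>

text \<open>Pythagoras at a common point. Since orthogonality includes that the circles meet, the
  converse also has to exhibit such a point.\<close>

lemma orthogonal_to_unit_circle_iff:
  assumes r: "r > 0"
  shows "orthogonal_circles p r 0 1 \<longleftrightarrow> (norm p)\<^sup>2 = 1 + r\<^sup>2"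
proof -
  have on_both: "orthogonal (z - p) (z - 0) \<longleftrightarrow> (norm p)\<^sup>2 = 1 + r\<^sup>2"
    if "z \<in> sphere p r \<inter> sphere 0 1" for z
  proof -
    have "norm (z - p) = r" "norm z = 1"
      using that by (auto simp: dist_norm norm_minus_commute)
    moreover have "2 * inner (z - p) z = (norm (z - p))\<^sup>2 + (norm z)\<^sup>2 - (norm p)\<^sup>2"
      unfolding power2_norm_eq_inner by (simp add: inner_simps inner_commute)
    ultimately show ?thesis unfolding orthogonal_def by auto
  qed
  moreover have "sphere p r \<inter> sphere 0 1 \<noteq> {}" if P: "(norm p)\<^sup>2 = 1 + r\<^sup>2"
  proof -
    have "0 < 1 + r\<^sup>2" by (simp add: add_pos_nonneg)
    then have p0: "p \<noteq> 0" using P by auto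
    have n: "norm (Complex 1 r) = norm p" "norm (Complex (- r\<^sup>2) r) = r * norm p"
    proof -
      have "norm p = sqrt (1 + r\<^sup>2)" using P by (metis norm_ge_zero real_sqrt_unique)
      moreover have "(- r\<^sup>2)\<^sup>2 + r\<^sup>2 = r\<^sup>2 * (1 + r\<^sup>2)"
        by (simp add: algebra_simps power2_eq_square)
      ultimately show "norm (Complex 1 r) = norm p" "norm (Complex (- r\<^sup>2) r) = r * norm p"
        using r by (simp_all only: complex_norm) (simp_all add: real_sqrt_mult)
    qed
    \<comment> \<open>The point where a tangent from \<open>p\<close> touches the unit circle: 0,
      \<open>?z\<close> and \<open>p\<close> form a right triangle with legs 1 and
      \<open>r\<close>.\<close>
    let ?z = "Complex 1 r * p / of_real ((norm p)\<^sup>2)"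
    have "norm ?z = 1"
      using n p0 by (simp add: norm_mult norm_divide power2_eq_square)
    moreover have "?z - p = Complex (- r\<^sup>2) r * p / of_real ((norm p)\<^sup>2)"
    proof -
      have "Complex (- r\<^sup>2) r = Complex 1 r - of_real ((norm p)\<^sup>2)"
        by (simp add: complex_eq_iff P)
      then show ?thesis using p0 by (simp add: left_diff_distrib diff_divide_distrib)
    qed
    then have "norm (?z - p) = r"
      using n p0 r by (simp add: norm_mult norm_divide power2_eq_square)
    ultimately have "?z \<in> sphere p r \<inter> sphere 0 1"
      by (simp add: dist_norm norm_minus_commute)
    then show ?thesis by blast
  qed
  ultimately show ?thesis unfolding orthogonal_circles_def by blast
qed

lemma norm_diff_sq: "(norm (x - p))\<^sup>2 = (norm x)\<^sup>2 - 2 * Re (x * cnj p) + (norm p)\<^sup>2"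
  unfolding cmod_power2 by (simp add: algebra_simps power2_eq_square)

lemma mem_orthogonal_circle_iff:
  assumes "r > 0" "(norm p)\<^sup>2 = 1 + r\<^sup>2"
  shows "x \<in> sphere p r \<longleftrightarrow> 2 * Re (x * cnj p) = 1 + (norm x)\<^sup>2"
proof -
  have "x \<in> sphere p r \<longleftrightarrow> (norm (x - p))\<^sup>2 = r\<^sup>2"
    using assms(1) by (auto simp: dist_norm norm_minus_commute power2_eq_iff_nonneg)
  then show ?thesis using norm_diff_sq[of x p] assms(2) by auto
qed

text \<open>Otherwise Cauchy-Schwarz would give \<open>(1 - norm a)\<^sup>2 \<le> 0\<close>. The
  radius \<open>sqrt ((norm p)\<^sup>2 - 1)\<close> is therefore positive.\<close>

lemma orthogonal_circle_center_outside:
  assumes "norm a < 1" "2 * Re (a * cnj p) = 1 + (norm a)\<^sup>2"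
  shows "norm p > 1"
proof (rule ccontr)
  assume "\<not> norm p > 1"
  then have "norm a * norm p \<le> norm a" by (simp add: mult_left_le)
  moreover have "Re (a * cnj p) \<le> norm a * norm p"
    using complex_Re_le_cmod[of "a * cnj p"] by (simp add: norm_mult)
  moreover have "(1 - norm a)\<^sup>2 > 0" using assms(1) by simp
  ultimately show False using assms(2) by (simp add: power2_eq_square algebra_simps)
qed

text \<open>Eliminating the radius leaves two real linear equations for the centre.\<close>

lemma ex_orthogonal_circle_iff:
  assumes a: "norm a < 1"
  shows "(\<exists>r>0. a \<in> sphere p r \<and> b \<in> sphere p r \<and> orthogonal_circles p r 0 1) \<longleftrightarrow>
    2 * Re (a * cnj p) = 1 + (norm a)\<^sup>2 \<and> 2 * Re (b * cnj p) = 1 + (norm b)\<^sup>2"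
    (is "?L \<longleftrightarrow> ?R")
proof
  assume ?L
  then show ?R using orthogonal_to_unit_circle_iff mem_orthogonal_circle_iff by blast
next
  assume R: ?R
  let ?r = "sqrt ((norm p)\<^sup>2 - 1)"
  have "norm p > 1" using orthogonal_circle_center_outside a R by blast
  then have "(norm p)\<^sup>2 > 1" by simp
  then have "?r > 0" "(norm p)\<^sup>2 = 1 + ?r\<^sup>2" by simp_all
  then show ?L using R orthogonal_to_unit_circle_iff mem_orthogonal_circle_iff by blast
qed

lemma collinear_0_iff: "collinear {a, b, 0} \<longleftrightarrow> Im (b * cnj a) = 0"
  by (simp only: insert_commute[of b] insert_commute[of a 0] collinear_iff_Reals complex_is_Real_iff
      Im_complex_div_eq_0)

text \<open>The linear system for the centre has determinant \<open>Im (b * cnj a)\<close>, which is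
  nonzero exactly off the collinear case.\<close>

lemma orth_center:
  assumes a: "norm a < 1" and nc: "\<not> collinear {a, b, 0}"
  shows "2 * Re (a * cnj (orth_center a b)) = 1 + (norm a)\<^sup>2"
    and "2 * Re (b * cnj (orth_center a b)) = 1 + (norm b)\<^sup>2"
proof -
  let ?det = "Re a * Im b - Im a * Re b"
  let ?A = "1 + (norm a)\<^sup>2" and ?B = "1 + (norm b)\<^sup>2"
  have det: "?det \<noteq> 0"
    using nc unfolding collinear_0_iff by (simp add: mult.commute)
  \<comment> \<open>Cramer's rule.\<close>
  define p where
    "p = Complex ((?A * Im b - ?B * Im a) / (2 * ?det)) ((?B * Re a - ?A * Re b) / (2 * ?det))"
  have p: "2 * Re (a * cnj p) = ?A" "2 * Re (b * cnj p) = ?B"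
  proof -
    have "2 * Re (a * cnj p) = (?A * ?det) / ?det" "2 * Re (b * cnj p) = (?B * ?det) / ?det"
      using det unfolding p_def by (simp_all add: divide_simps) (simp_all add: algebra_simps)
    then show "2 * Re (a * cnj p) = ?A" "2 * Re (b * cnj p) = ?B" using det by simp_all
  qed
  have "\<exists>!p. \<exists>r>0. a \<in> sphere p r \<and> b \<in> sphere p r \<and> orthogonal_circles p r 0 1"
    unfolding ex_orthogonal_circle_iff[OF a]
  proof (rule ex1I[of _ p])
    fix q assume q: "2 * Re (a * cnj q) = ?A \<and> 2 * Re (b * cnj q) = ?B"
    have "?det * (Re q - Re p) = 0" "?det * (Im q - Im p) = 0"
      using p q by simp_all algebra+
    then show "q = p" using det by (simp add: complex_eq_iff)
  qed (use p in blast)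
  from theI'[OF this] show "2 * Re (a * cnj (orth_center a b)) = ?A"
    "2 * Re (b * cnj (orth_center a b)) = ?B"
    unfolding orth_center_def ex_orthogonal_circle_iff[OF a] by blast+
qed

lemma hyp_line_noncollinear:
  assumes a: "norm a < 1" and nc: "\<not> collinear {a, b, 0}"
  shows "hyp_line a b = {x. norm x < 1 \<and> 2 * Re (x * cnj (orth_center a b)) = 1 + (norm x)\<^sup>2}"
proof -
  let ?p = "orth_center a b"
  have "2 * Re (a * cnj ?p) = 1 + (norm a)\<^sup>2 \<and> 2 * Re (b * cnj ?p) = 1 + (norm b)\<^sup>2"
    using orth_center[OF a nc] by blast
  then obtain r where r: "r > 0" "a \<in> sphere ?p r" "orthogonal_circles ?p r 0 1"
    unfolding ex_orthogonal_circle_iff[OF a, symmetric] by blast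
  then have "orth_circle a b = sphere ?p r" "(norm ?p)\<^sup>2 = 1 + r\<^sup>2"
    by (auto simp: orth_circle_def orthogonal_to_unit_circle_iff)
  then show ?thesis
    using mem_orthogonal_circle_iff[OF r(1)] nc by (auto simp: hyp_line_def)
qed

lemma nearest_origin_collinear:
  assumes "a \<noteq> b" "collinear {a, b, 0}"
  shows "hyp_line_nearest_origin a b = 0"
proof -
  have "0 \<in> hyp_line a b"
    using assms collinear_3_affine_hull[of a b] by (auto simp: hyp_line_def)
  then show ?thesis
    unfolding hyp_line_nearest_origin_def by (intro the_equality) force+
qed

text \<open>With \<open>r\<close> the radius of the circle, Cauchy-Schwarz turns its equation into
  \<open>(t - norm x)\<^sup>2 \<le> r\<^sup>2\<close>, so \<open>norm x \<ge> t - r\<close>.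
  Equality holds only at the point \<open>k'\<close> where the circle meets the segment from 0 to
  \<open>p\<close>.\<close>

lemma nearest_origin_noncollinear:
  assumes a: "norm a < 1" and nc: "\<not> collinear {a, b, 0}"
  defines "p \<equiv> orth_center a b"
  defines "t \<equiv> norm p"
  defines "k \<equiv> hyp_line_nearest_origin a b"
  shows "k = p / of_real t * of_real (t - sqrt (t\<^sup>2 - 1))"
    and "norm k < 1" and "2 * Re (k * cnj p) = 1 + (norm k)\<^sup>2"
proof -
  define r where "r = sqrt (t\<^sup>2 - 1)"
  define k' where "k' = p / of_real t * of_real (t - r)"
  have L: "hyp_line a b = {x. norm x < 1 \<and> 2 * Re (x * cnj p) = 1 + (norm x)\<^sup>2}"
    unfolding p_def by (rule hyp_line_noncollinear[OF a nc])
  have t: "t > 1"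
    unfolding t_def p_def by (rule orthogonal_circle_center_outside[OF a orth_center(1)[OF a nc]])
  then have "t\<^sup>2 > 1" by simp
  then have r2: "r\<^sup>2 = t\<^sup>2 - 1" and r0: "r > 0" by (simp_all add: r_def)
  have "r\<^sup>2 < t\<^sup>2" using r2 by simp
  then have r1: "r < t" using t by (intro power2_less_imp_less[of r t]) auto
  \<comment> \<open>This puts \<open>k'\<close> inside the unit disk.\<close>
  have "(t - 1)\<^sup>2 < r\<^sup>2" using t unfolding r2 by (simp add: power2_eq_square algebra_simps)
  then have r3: "t - 1 < r" using r0 by (intro power2_less_imp_less[of "t - 1" r]) auto
  have nk: "norm k' = t - r"
    unfolding k'_def norm_mult norm_divide norm_of_real using t r1 by (simp add: t_def[symmetric])
  have Rk: "Re (x * cnj k') = (t - r) / t * Re (x * cnj p)" for x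
  proof -
    have "x * cnj k' = of_real ((t - r) / t) * (x * cnj p)" by (simp add: k'_def)
    moreover have "Re (of_real s * z) = s * Re z" for s z by simp
    ultimately show ?thesis by (simp only:)
  qed
  have k'p: "Re (k' * cnj p) = t * (t - r)"
  proof -
    have "Re (k' * cnj k') = (t - r)\<^sup>2" unfolding complex_norm_square[symmetric] nk by simp
    moreover have "X = t * s" if "s / t * X = s\<^sup>2" "s \<noteq> 0" for s X
      using that t by (simp add: field_simps power2_eq_square)
    ultimately show ?thesis unfolding Rk using r1 by simp
  qed
  have k'L: "k' \<in> hyp_line a b"
    unfolding L using r3 r2 by (simp add: nk k'p del: times_complex.sel) (simp add: power2_eq_square algebra_simps)
  have le: "norm k' \<le> norm x" and eq: "norm x = norm k' \<Longrightarrow> x = k'" if "x \<in> hyp_line a b" for x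
  proof -
    from that have x: "norm x < 1" "2 * Re (x * cnj p) = 1 + (norm x)\<^sup>2" by (simp_all add: L)
    have "Re (x * cnj p) \<le> norm x * t"
      using complex_Re_le_cmod[of "x * cnj p"] by (simp add: norm_mult t_def)
    then have "(t - norm x)\<^sup>2 \<le> r\<^sup>2" unfolding r2 using x(2) by (simp add: power2_eq_square algebra_simps)
    then have "t - norm x \<le> r" using r0 power2_le_imp_le by (meson less_imp_le)
    then show "norm k' \<le> norm x" by (simp add: nk)
    assume e: "norm x = norm k'"
    \<comment> \<open>The circle equation makes \<open>Re (x * cnj p)\<close> a function of
      \<open>norm x\<close>. Equal norms thus give
      \<open>Re (x * cnj k') = (norm k')\<^sup>2\<close>, and \<open>norm (x - k')\<close>
      vanishes.\<close>
    have "2 * Re (x * cnj k') = (t - r) / t * (2 * Re (x * cnj p))" unfolding Rk by simp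
    also have "2 * Re (x * cnj p) = 2 * (t * (t - r))"
      unfolding x(2) e nk using r2 by (simp add: power2_eq_square algebra_simps)
    also have "(t - r) / t * \<dots> = 2 * (norm k')\<^sup>2" using t by (simp add: nk power2_eq_square)
    finally have "(norm (x - k'))\<^sup>2 = 0" unfolding norm_diff_sq e by simp
    then show "x = k'" by simp
  qed
  have "k = k'"
    unfolding k_def hyp_line_nearest_origin_def
    by (rule the_equality) (use k'L le eq in \<open>auto intro: antisym\<close>)
  then show "k = p / of_real t * of_real (t - r)" by (simp add: k'_def r_def)
  show "norm k < 1" "2 * Re (k * cnj p) = 1 + (norm k)\<^sup>2" using k'L by (auto simp: \<open>k = k'\<close> L)
qed

text \<open>\<^term>\<open>T1 z\<close> carries the geodesic with centre \<open>p\<close> through \<open>z\<close> to a diameter; the second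
  factor is the conjugate of a normal vector of that diameter.\<close>

lemma T1_orthogonal_circle:
  assumes z: "norm z < 1" and x: "norm x < 1"
    and zp: "2 * Re (z * cnj p) = 1 + (norm z)\<^sup>2" and xp: "2 * Re (x * cnj p) = 1 + (norm x)\<^sup>2"
  shows "Re (T1 z x * (2 * cnj z - cnj p - (cnj z)\<^sup>2 * p)) = 0"
proof -
  let ?M = "2 * cnj z - cnj p - (cnj z)\<^sup>2 * p"
  have mem: "y * cnj p + cnj y * p = 1 + y * cnj y" if "2 * Re (y * cnj p) = 1 + (norm y)\<^sup>2" for y
  proof -
    have "y * cnj p + cnj y * p = of_real (2 * Re (y * cnj p))"
      using complex_add_cnj[of "y * cnj p"] by (simp del: times_complex.sel)
    then show ?thesis unfolding that of_real_add complex_norm_square by simp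
  qed
  define d where "d = 1 - cnj z * x"
  \<comment> \<open>Extending the fraction by \<open>cnj d\<close> makes its denominator real, so it
    suffices that \<open>W\<close> is purely imaginary.\<close>
  define W where "W = (x - z) * cnj d * ?M"
  have d: "d \<noteq> 0" unfolding d_def by (rule one_minus_cnj_mult_nonzero[OF z x])
  have "W + cnj W = 0"
    using mem[OF zp] mem[OF xp] unfolding W_def d_def by simp algebra
  then have "Re W = 0" using complex_add_cnj[of W] by simp
  moreover have "T1 z x * ?M = W / of_real ((norm d)\<^sup>2)"
    unfolding W_def complex_norm_square T1_def d_def[symmetric] using d by simp
  ultimately show ?thesis by (metis Re_divide_of_real div_0)
qed

text \<open>If the vector vanished, the real part of its product with \<open>z\<close> would give
  \<open>(1 - (norm z)\<^sup>2)\<^sup>2 = 0\<close>. Hence the orthogonality relation really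
  determines a diameter.\<close>

lemma orthogonal_circle_normal_nonzero:
  assumes z: "norm z < 1" and zp: "2 * Re (z * cnj p) = 1 + (norm z)\<^sup>2"
  shows "2 * cnj z - cnj p - (cnj z)\<^sup>2 * p \<noteq> 0"
proof
  let ?N = "(norm z)\<^sup>2"
  assume M: "2 * cnj z - cnj p - (cnj z)\<^sup>2 * p = 0"
  have "z * (2 * cnj z - cnj p - (cnj z)\<^sup>2 * p) = of_real (2 * ?N) - z * cnj p - of_real ?N * cnj (z * cnj p)"
    unfolding of_real_mult complex_norm_square by (simp add: power2_eq_square algebra_simps)
  with M have "Re (of_real (2 * ?N) - z * cnj p - of_real ?N * cnj (z * cnj p)) = 0" by simp
  then have "2 * ?N - (1 + ?N) * Re (z * cnj p) = 0" by (simp add: algebra_simps)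
  then have "(1 - ?N)\<^sup>2 = 0" using zp by algebra
  then show False using one_minus_norm_sq_pos[OF z] by simp
qed

text \<open>Both \<open>s\<close> and \<open>t\<close> are orthogonal to the nonzero vector
  \<open>cnj M\<close>, hence lie on one line through 0.\<close>

lemma Im_mult_cnj_eq_0:
  assumes "M \<noteq> 0" "Re (s * M) = 0" "Re (t * M) = 0"
  shows "Im (s * cnj t) = 0"
proof -
  have "Re M * Im (s * cnj t) = 0" "Im M * Im (s * cnj t) = 0" using assms(2,3) by simp_all algebra+
  then show ?thesis using assms(1) by (auto simp: complex_eq_iff)
qed

subsection \<open>The map \<^const>\<open>T2\<close>\<close>

text \<open>Geodesics are straight in the Klein model: divided by
  \<open>1 + (norm x)\<^sup>2\<close>, the circle equation is linear in the Klein point of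
  \<open>x\<close>, and that of \<open>h\<close> is a combination of those of \<open>a\<close> and
  \<open>b\<close>.\<close>

lemma antipodal_point_on_orthogonal_circle:
  assumes a: "norm a < 1" and b: "norm b < 1" and h: "norm h < 1"
    and ap: "2 * Re (a * cnj p) = 1 + (norm a)\<^sup>2" and bp: "2 * Re (b * cnj p) = 1 + (norm b)\<^sup>2"
    and anti: "T1 h a = - T1 h b"
  shows "2 * Re (h * cnj p) = 1 + (norm h)\<^sup>2"
proof -
  let ?A = "(norm a)\<^sup>2" and ?B = "(norm b)\<^sup>2" and ?S = "1 + (norm h)\<^sup>2"
  let ?D = "1 - (norm a * norm b)\<^sup>2"
  have "norm a * norm b < 1"
    using a b mult_strict_mono'[of "norm a" 1 "norm b" 1] by simp
  then have D: "?D > 0"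
    by (simp add: power_less_one_iff)
  have S: "?S > 0" by (simp add: add_pos_nonneg)
  have "2 * h / of_real ?S * cnj p
      = (of_real (1 - ?B) * (a * cnj p) + of_real (1 - ?A) * (b * cnj p)) / of_real ?D"
    unfolding T1_antipodal_iff[OF a b h, THEN iffD1, OF anti] by (simp add: algebra_simps)
  moreover have Re_mult: "Re (of_real x * z) = x * Re z" "Re (2 * z) = 2 * Re z" for x z by simp_all
  have "Re (2 * h / of_real ?S * cnj p) = 2 * Re (h * cnj p) / ?S"
    unfolding times_divide_eq_left Re_divide_of_real mult.assoc Re_mult ..
  ultimately
  have "2 * Re (h * cnj p) / ?S = ((1 - ?B) * Re (a * cnj p) + (1 - ?A) * Re (b * cnj p)) / ?D"
    unfolding times_divide_eq_left Re_divide_of_real plus_complex.sel Re_mult by (metis Re_divide_of_real Re_mult(1) plus_complex.sel(1))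
  \<comment> \<open>By the circle equations this is
    \<open>(1 - A) * (1 + B) + (1 - B) * (1 + A) = 2 * (1 - A * B)\<close>, halved.\<close>
  also have "(1 - ?B) * Re (a * cnj p) + (1 - ?A) * Re (b * cnj p) = ?D"
    using ap bp unfolding power_mult_distrib by algebra
  finally show ?thesis using D S by (simp add: field_simps)
qed

text \<open>The point sent to 0 is \<open>1 / cnj c\<close>, the reflection of \<open>c\<close> in
  the unit circle. The third conclusion bounds it away from that circle, the fourth puts
  \<open>c\<close> on the line through \<open>u\<close> and \<open>v\<close>, and the last encodes
  that \<open>u\<close> is mapped to \<open>v\<close>.\<close>

lemma T2_rotated_T1:
  fixes u v :: complex
  assumes u: "norm u < 1" and v: "norm v < 1" and v0: "v \<noteq> 0" and uv: "norm u \<noteq> norm v"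
  defines "c \<equiv> (u - v + u * v * (cnj u - cnj v)) / of_real ((norm u)\<^sup>2 - (norm v)\<^sup>2)"
  obtains \<theta> where "norm \<theta> = 1" "T2 u v = (\<lambda>z. \<theta> * T1 (1 / cnj c) z)" "norm c > 1"
    "c - u = (u - v) * of_real ((1 - (norm u)\<^sup>2) / ((norm u)\<^sup>2 - (norm v)\<^sup>2))"
    "1 - cnj c * u = cnj v * (c - u)"
proof -
  let ?d = "(norm u)\<^sup>2 - (norm v)\<^sup>2"
  let ?D = "of_real ?d :: complex"
  have d: "?d \<noteq> 0" using uv by (simp add: power2_eq_iff_nonneg)
  then have D: "?D \<noteq> 0" unfolding of_real_eq_0_iff .
  have Deq: "?D = u * cnj u - v * cnj v" unfolding of_real_diff complex_norm_square ..
  have cD: "c * ?D = u - v + u * v * (cnj u - cnj v)" unfolding c_def using D by simp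
  have cnjD: "cnj ?D = ?D" by simp
  have ccD: "cnj c * ?D = cnj u - cnj v + cnj u * cnj v * (u - v)"
    using arg_cong[OF cD, of cnj] unfolding complex_cnj_mult cnjD by simp
  have "(c - u) * ?D = (u - v) * of_real (1 - (norm u)\<^sup>2)"
    unfolding left_diff_distrib cD unfolding Deq of_real_diff of_real_1 complex_norm_square
    by (simp add: algebra_simps)
  then have cu: "c - u = (u - v) * of_real ((1 - (norm u)\<^sup>2) / ?d)"
    unfolding of_real_divide using D by (simp add: eq_divide_eq)
  have "(1 - cnj c * u) * ?D = cnj v * (c - u) * ?D"
  proof -
    have "(1 - cnj c * u) * ?D = ?D - (cnj c * ?D) * u"
      "cnj v * (c - u) * ?D = cnj v * (c * ?D - u * ?D)" by (simp_all add: algebra_simps)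
    then show ?thesis unfolding cD ccD unfolding Deq by (simp add: algebra_simps)
  qed
  then have ucv: "1 - cnj c * u = cnj v * (c - u)" using D by simp
  \<comment> \<open>The right-hand side is positive, which gives \<open>norm c > 1\<close>.\<close>
  have "(c * cnj c - 1) * ?D\<^sup>2 = of_real ((norm (u - v))\<^sup>2 * ((1 - (norm u)\<^sup>2) * (1 - (norm v)\<^sup>2)))"
  proof -
    have "(c * cnj c - 1) * ?D\<^sup>2 = (c * ?D) * (cnj c * ?D) - ?D\<^sup>2"
      by (simp add: algebra_simps power2_eq_square)
    then show ?thesis
      unfolding cD ccD unfolding Deq of_real_mult of_real_diff of_real_1 complex_norm_square
      by (simp add: algebra_simps power2_eq_square)
  qed
  then have "of_real (((norm c)\<^sup>2 - 1) * ?d\<^sup>2)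
      = (of_real ((norm (u - v))\<^sup>2 * ((1 - (norm u)\<^sup>2) * (1 - (norm v)\<^sup>2))) :: complex)"
    unfolding of_real_mult of_real_diff of_real_1 of_real_power complex_norm_square[of c, unfolded of_real_power] .
  then have "((norm c)\<^sup>2 - 1) * ?d\<^sup>2 = (norm (u - v))\<^sup>2 * ((1 - (norm u)\<^sup>2) * (1 - (norm v)\<^sup>2))"
    unfolding of_real_eq_iff .
  moreover have "\<dots> > 0"
    using uv one_minus_norm_sq_pos[OF u] one_minus_norm_sq_pos[OF v]
    by (intro mult_pos_pos) auto
  ultimately have "(norm c)\<^sup>2 > 1"
    by (metis diff_gt_0_iff_gt zero_less_mult_pos2 zero_less_power2 d)
  then have c: "norm c > 1" using power_le_one[of "norm c" 2] by (meson linorder_not_le norm_ge_zero)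
  then have c0: "c \<noteq> 0" by auto
  show ?thesis
  proof (rule that[OF _ _ c cu ucv])
    let ?\<theta> = "- (v / cnj v * (cnj c / c))"
    show "norm ?\<theta> = 1" using v0 c0 by (simp add: norm_mult norm_divide)
    show "T2 u v = (\<lambda>z. ?\<theta> * T1 (1 / cnj c) z)"
    proof
      fix z
      have "T1 (1 / cnj c) z = - (c / cnj c * ((cnj c * z - 1) / (z - c)))"
      proof -
        have "z - 1 / cnj c = (cnj c * z - 1) / cnj c" "1 - cnj (1 / cnj c) * z = - ((z - c) / c)"
          using c0 by (simp_all add: field_simps)
        then show ?thesis unfolding T1_def by simp
      qed
      then show "T2 u v z = ?\<theta> * T1 (1 / cnj c) z"
        using c0 unfolding T2_def Let_def c_def[symmetric] by simp
    qed
  qed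
qed

text \<open>The last hypothesis says that \<open>s\<close> is orthogonal to \<open>T1 h u\<close>.\<close>

lemma norm_T1_antipodal_eq:
  assumes u: "norm u < 1" and h: "norm h < 1" and s: "norm s < 1"
    and orth: "Re ((1 - cnj u * h) * cnj ((cnj h - cnj u) * s)) = 0"
  shows "norm (T1 u (T1 (- h) s)) = norm (T1 u (T1 (- h) (- s)))"
proof -
  let ?P = "1 - cnj u * h" and ?Q = "(cnj h - cnj u) * s"
  \<comment> \<open>Only \<open>norm t\<close> and the norm in the denominator depend on
    \<open>t\<close>, so comparing \<open>s\<close> with \<open>- s\<close> reduces to
    \<open>norm (P + Q) = norm (P - Q)\<close>, that is, to orthogonality of \<open>P\<close> and
    \<open>Q\<close>.\<close>
  have eq: "1 - (norm (T1 u (T1 (- h) t)))\<^sup>2 =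
      (1 - (norm u)\<^sup>2) * ((1 - (norm h)\<^sup>2) * (1 - (norm t)\<^sup>2)) / (norm (?P + (cnj h - cnj u) * t))\<^sup>2"
    if t: "norm t < 1" for t
  proof -
    have h': "norm (- h) < 1" using h by simp
    have nz: "1 - cnj (- h) * t \<noteq> 0" by (rule one_minus_cnj_mult_nonzero[OF h' t])
    then have "1 - cnj u * T1 (- h) t = (?P + (cnj h - cnj u) * t) / (1 - cnj (- h) * t)"
      unfolding T1_def by (simp add: diff_divide_distrib[symmetric] field_simps)
    then show ?thesis
      unfolding one_minus_norm_T1[OF u norm_T1_less_1[OF h' t]] one_minus_norm_T1[OF h' t]
      using nz by (simp add: norm_divide power_divide)
  qed
  have "(norm (?P + ?Q))\<^sup>2 = (norm (?P - ?Q))\<^sup>2"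
  proof -
    have "(norm (?P + ?Q))\<^sup>2 - (norm (?P - ?Q))\<^sup>2 = 4 * Re (?P * cnj ?Q)"
      unfolding cmod_power2 by (simp add: algebra_simps power2_eq_square)
    then show ?thesis using orth by simp
  qed
  then have "1 - (norm (T1 u (T1 (- h) s)))\<^sup>2 = 1 - (norm (T1 u (T1 (- h) (- s))))\<^sup>2"
    using eq[of s] eq[of "- s"] s by simp
  then show ?thesis by (simp add: power2_eq_iff_nonneg)
qed

text \<open>Seen from \<open>h\<close>, the points \<open>a\<close> and \<open>b\<close> become
  \<open>s\<close> and \<open>- s\<close>, so \<open>norm_T1_antipodal_eq\<close> applies once its
  orthogonality condition is verified. That condition is traced back to \<open>k\<close> being the
  foot of the perpendicular from 0.\<close>

lemma T2_equal_norms: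
  assumes a: "norm a < 1" and b: "norm b < 1" and h: "norm h < 1" and k: "norm k < 1"
    and ap: "2 * Re (a * cnj p) = 1 + (norm a)\<^sup>2" and hp: "2 * Re (h * cnj p) = 1 + (norm h)\<^sup>2"
    and kp: "2 * Re (k * cnj p) = 1 + (norm k)\<^sup>2" and k_ray: "p = of_real \<mu> * k"
    and anti: "T1 h a = - T1 h b" and k0: "k \<noteq> 0" and hk: "norm h \<noteq> norm k"
  shows "norm (T2 h k a) = norm (T2 h k b)" and "disk_moebius (T2 h k)"
proof -
  obtain \<theta> c where \<theta>: "norm \<theta> = 1" and T2: "T2 h k = (\<lambda>z. \<theta> * T1 (1 / cnj c) z)"
    and c: "norm c > 1"
    and ch: "c - h = (h - k) * of_real ((1 - (norm h)\<^sup>2) / ((norm h)\<^sup>2 - (norm k)\<^sup>2))" (is "_ = _ * of_real ?e")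
    and hc: "1 - cnj c * h = cnj k * (c - h)"
    using T2_rotated_T1[OF h k k0 hk] by metis
  let ?u = "1 / cnj c"
  have u: "norm ?u < 1" and c0: "c \<noteq> 0" using c by (auto simp: norm_divide divide_less_eq)
  show "disk_moebius (T2 h k)" unfolding T2 by (rule disk_moebius_rotated_T1[OF u \<theta>])
  define s where "s = T1 h a"
  define q where "q = T1 h k"
  define d where "d = 1 - cnj h * k"
  have s: "norm s < 1" unfolding s_def by (rule norm_T1_less_1[OF h a])
  have d: "d \<noteq> 0" unfolding d_def by (rule one_minus_cnj_mult_nonzero[OF h k])
  have q: "q * d = k - h" using d by (simp add: q_def T1_def d_def)
  have "q \<noteq> 0" using q hk by auto
  \<comment> \<open>The points \<open>a\<close> and \<open>k\<close> lie on a geodesic through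
    \<open>h\<close>, so \<open>T1 h\<close> sends both to one diameter and \<open>s\<close> is a
    real multiple of \<open>q\<close>.\<close>
  have "Im (s * cnj q) = 0"
    using Im_mult_cnj_eq_0[OF orthogonal_circle_normal_nonzero[OF h hp]
        T1_orthogonal_circle[OF h a hp ap] T1_orthogonal_circle[OF h k hp kp]]
    by (simp add: s_def q_def)
  then have "s * cnj q = of_real (Re (s * cnj q))" by (simp add: complex_eq_iff)
  then have "s * (q * cnj q) = of_real (Re (s * cnj q)) * q" by (metis mult.assoc mult.commute)
  moreover obtain n where n: "n = (norm q)\<^sup>2" "n > 0" using \<open>q \<noteq> 0\<close> by simp
  ultimately have sq: "s = of_real (Re (s * cnj q) / n) * q"
    unfolding complex_norm_square[symmetric] n(1)[symmetric] of_real_divide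
    by (simp add: field_simps)
  text \<open>\<open>k\<close> is the foot of the perpendicular from \<open>0\<close>, so \<open>T1 k\<close> maps \<open>h\<close> to a point
    orthogonal to \<open>k\<close>.\<close>
  have perp: "Re (k * (cnj h - cnj k) * cnj d) = 0"
  proof -
    let ?H = "(norm h)\<^sup>2" and ?K = "(norm k)\<^sup>2"
    \<comment> \<open>Eliminating \<open>\<mu>\<close> from the circle equations of \<open>h\<close>
      and \<open>k\<close> removes the centre.\<close>
    have "2 * \<mu> * Re (h * cnj k) = 1 + ?H" "2 * \<mu> * ?K = 1 + ?K"
      using hp kp unfolding k_ray cmod_power2 by (simp_all add: algebra_simps power2_eq_square)
    then have L: "(1 + ?K) * Re (h * cnj k) = ?K * (1 + ?H)" by algebra
    have "k * (cnj h - cnj k) * cnj d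
        = cnj (h * cnj k) - of_real ?K - of_real ?K * of_real ?H + of_real ?K * (h * cnj k)"
      unfolding d_def complex_norm_square by (simp add: algebra_simps)
    moreover have Re_rules: "Re (cnj z) = Re z" "Re (of_real x * z) = x * Re z" "Re (of_real x) = x" for x z
      by simp_all
    ultimately have "Re (k * (cnj h - cnj k) * cnj d)
        = Re (h * cnj k) - ?K - ?K * ?H + ?K * Re (h * cnj k)"
      by (simp only: plus_complex.sel minus_complex.sel Re_rules)
    then show ?thesis using L by (simp add: algebra_simps)
  qed
  \<comment> \<open>Substituting \<open>hc\<close>, \<open>ch\<close> and \<open>sq\<close> shows
    this number to be a real multiple of the conjugate of the one in \<open>perp\<close>.\<close>
  have "Re ((1 - cnj ?u * h) * cnj ((cnj h - cnj ?u) * s)) = 0"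
  proof -
    let ?X = "(1 - cnj ?u * h) * cnj ((cnj h - cnj ?u) * s)"
    have eqs: "1 - cnj ?u * h = (c - h) / c" "cnj h - cnj ?u = - cnj (1 - cnj c * h) / c"
      using c0 by (simp_all add: field_simps)
    have "Z / c * cnj (- cnj Y / c * s) = - (Z * Y * cnj s) / (c * cnj c)" for Y Z
      by simp
    then have "?X = - ((c - h) * (1 - cnj c * h) * cnj s) / (c * cnj c)"
      unfolding eqs .
    also have "(c - h) * (1 - cnj c * h) * cnj s = of_real (?e\<^sup>2 * Re (s * cnj q) / n) * ((h - k)\<^sup>2 * cnj k * cnj q)"
      unfolding hc ch by (subst sq) (simp add: power2_eq_square mult_ac)
    also have "(h - k)\<^sup>2 * cnj k * cnj q = - of_real ((norm (h - k))\<^sup>2 / (norm d)\<^sup>2) * cnj (k * (cnj h - cnj k) * cnj d)"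
    proof -
      have cq: "cnj q = cnj (k - h) / cnj d" using d by (simp add: q[symmetric])
      show ?thesis using d unfolding cq of_real_divide complex_norm_square
        by (simp add: divide_simps) (simp add: power2_eq_square algebra_simps)
    qed
    finally have "?X = of_real (?e\<^sup>2 * Re (s * cnj q) / n * ((norm (h - k))\<^sup>2 / (norm d)\<^sup>2) / (norm c)\<^sup>2)
        * cnj (k * (cnj h - cnj k) * cnj d)"
      unfolding complex_norm_square[symmetric] of_real_mult of_real_divide by simp
    moreover have "Re (of_real x * cnj z) = x * Re z" for x z by simp
    ultimately show ?thesis using perp by (simp only: mult_zero_right)
  qed
  from norm_T1_antipodal_eq[OF u h s this]
  have "norm (T1 ?u (T1 (- h) (T1 h a))) = norm (T1 ?u (T1 (- h) (T1 h b)))"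
    unfolding s_def using anti by simp
  moreover have "T1 (- h) (T1 h x) = x" if "norm x < 1" for x
    using T1_T1_minus[of "- h" x] h that by simp
  ultimately show "norm (T2 h k a) = norm (T2 h k b)"
    using a b by (simp add: T2 norm_mult)
qed

theorem theorem5p1:
  fixes a b h k :: complex
  assumes "a \<in> unit_disk - {0}" and "b \<in> unit_disk - {0}" and "a \<noteq> b"
    and k: "k = hyp_line_nearest_origin a b"
    and h: "h = hyp_midpoint a b"
  shows "(collinear {a, b, 0} \<longrightarrow> k = 0) \<and>
    (\<not> collinear {a, b, 0} \<longrightarrow>
      (let p = orth_center a b; t = norm p
       in k = p / complex_of_real t * complex_of_real (t - sqrt (t\<^sup>2 - 1)))) \<and>
    (\<exists>m1 m2 m3. disk_moebius m1 \<and> disk_moebius m2 \<and> disk_moebius m3 \<and>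
      (m1 a = - m1 b \<and> Lip m1 \<le> Lip (T1 h) \<and>
        Lip (T1 h) = ereal ((1 + norm h) / (1 - norm h))) \<and>
      (collinear {m2 a, m2 b, 0} \<and> Lip m2 \<le> Lip (T1 k) \<and>
        Lip (T1 k) = ereal ((1 + norm k) / (1 - norm k))) \<and>
      (h \<noteq> 0 \<and> k \<noteq> 0 \<and> norm h \<noteq> norm k \<longrightarrow>
        norm (m3 a) = norm (m3 b) \<and> Lip m3 \<le> Lip (T2 h k)))"
proof -
  have a: "norm a < 1" and b: "norm b < 1" using assms by auto
  have h1: "norm h < 1" and anti: "T1 h a = - T1 h b"
    unfolding h using hyp_midpoint[OF a b] by auto
  have k_col: "k = 0" if "collinear {a, b, 0}"
    unfolding k using that \<open>a \<noteq> b\<close> by (rule nearest_origin_collinear[rotated])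
  define p where "p = orth_center a b"
  have nc: "k = p / of_real (norm p) * of_real (norm p - sqrt ((norm p)\<^sup>2 - 1))" "norm k < 1"
    "2 * Re (a * cnj p) = 1 + (norm a)\<^sup>2" "2 * Re (b * cnj p) = 1 + (norm b)\<^sup>2"
    "2 * Re (h * cnj p) = 1 + (norm h)\<^sup>2" "2 * Re (k * cnj p) = 1 + (norm k)\<^sup>2"
    if "\<not> collinear {a, b, 0}"
    using nearest_origin_noncollinear[OF a that] orth_center[OF a that]
      antipodal_point_on_orthogonal_circle[OF a b h1 _ _ anti]
    by (simp_all only: k p_def)
  have k1: "norm k < 1" using k_col nc(2) by fastforce
  have col: "collinear {T1 k a, T1 k b, 0}"
  proof (cases "collinear {a, b, 0}")
    case True
    then show ?thesis using k_col by (simp add: T1_0)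
  next
    case False
    note nc = nc[OF this]
    show ?thesis
      unfolding collinear_0_iff
      by (rule Im_mult_cnj_eq_0[OF orthogonal_circle_normal_nonzero[OF k1 nc(6)]
          T1_orthogonal_circle[OF k1 b nc(6,4)] T1_orthogonal_circle[OF k1 a nc(6,3)]])
  qed
  have m3: "norm (T2 h k a) = norm (T2 h k b) \<and> disk_moebius (T2 h k)"
    if "k \<noteq> 0" "norm h \<noteq> norm k"
  proof -
    note nc = nc[OF contrapos_nn[OF \<open>k \<noteq> 0\<close> k_col]]
    define r where "r = (norm p - sqrt ((norm p)\<^sup>2 - 1)) / norm p"
    have "k = of_real r * p" using nc(1) by (simp add: r_def)
    then have "p = of_real (1 / r) * k" using \<open>k \<noteq> 0\<close> by auto
    then show ?thesis
      using T2_equal_norms[OF a b h1 k1 nc(3,5,6) _ anti that] by blast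
  qed
  \<comment> \<open>If \<open>k = 0\<close> or \<open>norm h = norm k\<close>, the implication is
    vacuous and \<open>T1 h\<close> serves as an arbitrary disk automorphism.\<close>
  have "\<exists>m3. disk_moebius m3 \<and> (h \<noteq> 0 \<and> k \<noteq> 0 \<and> norm h \<noteq> norm k \<longrightarrow>
        norm (m3 a) = norm (m3 b) \<and> Lip m3 \<le> Lip (T2 h k))"
    using m3 disk_moebius_T1[OF h1] by (cases "k \<noteq> 0 \<and> norm h \<noteq> norm k") auto
  then show ?thesis
    using k_col nc(1) anti col disk_moebius_T1[OF h1] disk_moebius_T1[OF k1] Lip_T1[OF h1] Lip_T1[OF k1]
    unfolding p_def Let_def by blast
qed

end
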